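(* Let $(\mathbb{K},|\cdot|)$ be a complete non-Archimedean valued field whose absolute value is not trivial, let $(X,\|\cdot\|)$ be an ultrametric Banach space over $\mathbb{K}$, and let $(X,\{A_n\})$ be an ultrametric approximation scheme. The following are equivalent: (a) For every sequence of real numbers $\{\varepsilon_n\}$ decreasing (non-increasingly) to $0$, there exists $x\in X$ such that $E(x,A_n)\neq \mathbf{O}(\varepsilon_n)$, i.e. there is no constant $M>0$ with $E(x,A_n)\le M\varepsilon_n$ for all $n\in\mathbb{N}$. (b) $\inf_{n\in\mathbb{N}}E(B(X),A_n)=c>0$.
   Context: An ultrametric approximation scheme $(X,\{A_n\})$ consists of an infinite chain $\{0\}=A_0\subset A_1\subset\cdots\subset A_n\subset\cdots\subset X$ of subsets with all inclusions strict, such that: (i) there is a map $K:\mathbb{N}\to\mathbb{N}$ (the jump function) with $K(n)\ge n$ and $A_n+A_n\subseteq A_{K(n)}$ for all $n$; (ii) $\lambda A_n\subseteq A_n$ for all $n$ and all $\lambda\in\mathbb{K}$; (iii) $\bigcup_n A_n$ is dense in $X$. Notation: $E(x,A)=\inf_{a\in A}\|x-a\|$, $E(B,A)=\sup_{b\in B}E(b,A)$, and $B(X)=\{x\in X:\|x\|\le 1\}$. *)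

theory Defs
  imports "HOL-Analysis.Abstract_Metric_Spaces"
begin

locale nonarch_valued_field =
  fixes absv :: "'k::field \<Rightarrow> real"
  assumes absv_nonneg: "0 \<le> absv a"
    and absv_eq_0_iff: "absv a = 0 \<longleftrightarrow> a = 0"
    and absv_mult: "absv (a * b) = absv a * absv b"
    and absv_add_le_max: "absv (a + b) \<le> max (absv a) (absv b)"

locale complete_nontrivial_nonarch_valued_field = nonarch_valued_field +
  assumes absv_nontrivial: "\<exists>a. a \<noteq> 0 \<and> absv a \<noteq> 1"
    and absv_complete: "Metric_space.mcomplete UNIV (\<lambda>a b. absv (a - b))"

locale ultrametric_normed_space =
  nonarch_valued_field absv + vector_space scale
  for absv :: "'k::field \<Rightarrow> real"
    and scale :: "'k \<Rightarrow> 'x::ab_group_add \<Rightarrow> 'x" +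
  fixes nrm :: "'x \<Rightarrow> real"
  assumes nrm_nonneg: "0 \<le> nrm x"
    and nrm_eq_0_iff: "nrm x = 0 \<longleftrightarrow> x = 0"
    and nrm_scale: "nrm (scale a x) = absv a * nrm x"
    and nrm_add_le_max: "nrm (x + y) \<le> max (nrm x) (nrm y)"

locale ultrametric_banach_space = ultrametric_normed_space +
  assumes nrm_complete: "Metric_space.mcomplete UNIV (\<lambda>x y. nrm (x - y))"

locale ultrametric_approximation_scheme =
  ultrametric_banach_space absv scale nrm
  for absv :: "'k::field \<Rightarrow> real"
    and scale :: "'k \<Rightarrow> 'x::ab_group_add \<Rightarrow> 'x"
    and nrm :: "'x \<Rightarrow> real" +
  fixes A :: "nat \<Rightarrow> 'x set"
  assumes A_0: "A 0 = {0}"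
    and A_strict_chain: "A n \<subset> A (Suc n)"
    and A_jump: "\<exists>K :: nat \<Rightarrow> nat. \<forall>n. n \<le> K n \<and> {x + y | x y. x \<in> A n \<and> y \<in> A n} \<subseteq> A (K n)"
    and A_scale: "scale a ` A n \<subseteq> A n"
    and A_dense: "Metric_space.mtopology UNIV (\<lambda>x y. nrm (x - y)) closure_of (\<Union>n. A n) = UNIV"

definition approx_error :: "('x::ab_group_add \<Rightarrow> real) \<Rightarrow> 'x \<Rightarrow> 'x set \<Rightarrow> real"
  where "approx_error nrm x A = (INF a\<in>A. nrm (x - a))"

text \<open>The supremum is a conditionally complete one, so it is meaningful only if
  the errors are bounded above on \<open>B\<close>. For the unit ball they are bounded by 1 as soon as
  \<open>0 \<in> A\<close>.\<close>

definition set_approx_error :: "('x::ab_group_add \<Rightarrow> real) \<Rightarrow> 'x set \<Rightarrow> 'x set \<Rightarrow> real"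
  where "set_approx_error nrm B A = (SUP b\<in>B. approx_error nrm b A)"

definition closed_unit_ball :: "('x \<Rightarrow> real) \<Rightarrow> 'x set"
  where "closed_unit_ball nrm = {x. nrm x \<le> 1}"

end

(* (a) implies (b): if the errors of the unit ball tend to 0 they form themselves a sequence
   for which (a) fails, because every vector is a multiple of a vector in the unit ball.
   (b) implies (a): if (a) fails for the sequence eps, the space is the union of the closed sets
   F k = {x. E(x, A n) <= k * eps n for all n}. By Baire's theorem some F k contains a ball.
   Subtracting the centre costs nothing in the ultrametric inequality except a passage from
   A n to A (K n), so after rescaling the errors E(B(X), A (K n)) are O(eps n), and the
   infimum in (b) vanishes. *)

theory Submission
  imports Defs "HOL-Analysis.Urysohn"
begin

section \<open>Scalars of large absolute value\<close>

text \<open>By nontriviality some \<open>b\<close> or its inverse has absolute value above 1, and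
  its powers exceed every bound. Such scalars do the rescaling: a vector cannot in general be
  normalised to norm exactly 1.\<close>

lemma (in complete_nontrivial_nonarch_valued_field) absv_unbounded:
  obtains a where "a \<noteq> 0" "r < absv a"
proof -
  have one: "absv 1 = 1"
    using absv_mult[of 1 1] absv_eq_0_iff[of 1] by simp
  obtain b where b: "b \<noteq> 0" "absv b \<noteq> 1"
    using absv_nontrivial by blast
  have inv: "absv b * absv (inverse b) = 1"
    using absv_mult[of b "inverse b"] b one by simp
  have "\<exists>c. c \<noteq> 0 \<and> 1 < absv c"
  proof (cases "1 < absv b")
    case False
    then have "absv b < 1" using b by simp
    moreover have "0 < absv b"
      using b absv_nonneg[of b] absv_eq_0_iff[of b] by simp
    ultimately have "1 < absv (inverse b)"
      using inv by (metis mult.commute inverse_unique one_less_inverse)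
    then show ?thesis using b by (metis nonzero_imp_inverse_nonzero)
  qed (use b in blast)
  then obtain c where c: "c \<noteq> 0" "1 < absv c" by blast
  have pow: "absv (c ^ n) = absv c ^ n" for n
    by (induction n) (simp_all add: one absv_mult)
  obtain n where "r < absv c ^ n"
    using real_arch_pow[OF c(2)] by blast
  then show thesis
    using that[of "c ^ n"] c pow by simp
qed

section \<open>Approximation errors in an ultrametric normed space\<close>

context ultrametric_normed_space
begin

lemma nrm_zero: "nrm 0 = 0"
  by (simp add: nrm_eq_0_iff)

lemma nrm_minus: "nrm (- x) = nrm x"
proof -
  have "absv (- 1) * absv (- 1) = 1"
    using absv_mult[of "-1" "-1"] absv_mult[of 1 1] absv_eq_0_iff[of 1] by simp
  then have "absv (- 1) = 1"
    using absv_nonneg[of "-1"] by (metis abs_of_nonneg abs_1 abs_square_eq_1 power2_eq_square)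
  then show ?thesis
    using nrm_scale[of "-1" x] by simp
qed

lemma nrm_minus_commute: "nrm (x - y) = nrm (y - x)"
  using nrm_minus[of "x - y"] by simp

lemma nrm_diff_le_max: "nrm (x - y) \<le> max (nrm x) (nrm y)"
  using nrm_add_le_max[of x "- y"] by (simp add: nrm_minus)

lemma Metric_space_nrm: "Metric_space UNIV (\<lambda>x y. nrm (x - y))"
proof
  fix x y z
  show "nrm (x - z) \<le> nrm (x - y) + nrm (y - z)"
    using nrm_add_le_max[of "x - y" "y - z"] nrm_nonneg[of "x - y"] nrm_nonneg[of "y - z"]
    by simp
qed (auto simp: nrm_nonneg nrm_eq_0_iff intro: nrm_minus_commute)

lemma bdd_below_nrm_diff: "bdd_below ((\<lambda>a. nrm (x - a)) ` A)"
  by (rule bdd_belowI[of _ 0]) (auto simp: nrm_nonneg)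

lemma approx_error_le: "a \<in> A \<Longrightarrow> approx_error nrm x A \<le> nrm (x - a)"
  unfolding approx_error_def by (rule cINF_lower[OF bdd_below_nrm_diff])

lemma approx_error_nonneg: "A \<noteq> {} \<Longrightarrow> 0 \<le> approx_error nrm x A"
  unfolding approx_error_def by (rule cINF_greatest) (auto simp: nrm_nonneg)

lemma approx_error_less_iff:
  "A \<noteq> {} \<Longrightarrow> approx_error nrm x A < r \<longleftrightarrow> (\<exists>a\<in>A. nrm (x - a) < r)"
  unfolding approx_error_def by (rule cINF_less_iff[OF _ bdd_below_nrm_diff])

lemma approx_error_antimono:
  "A \<noteq> {} \<Longrightarrow> A \<subseteq> B \<Longrightarrow> approx_error nrm x B \<le> approx_error nrm x A"
  unfolding approx_error_def by (rule cINF_superset_mono[OF _ bdd_below_nrm_diff]) auto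

lemma approx_error_scale_le:
  assumes "A \<noteq> {}" "l \<noteq> 0" "scale l ` A \<subseteq> A"
  shows "approx_error nrm (scale l x) A \<le> absv l * approx_error nrm x A"
proof -
  have pos: "0 < absv l"
    using absv_nonneg[of l] absv_eq_0_iff[of l] assms(2) by simp
  have "approx_error nrm (scale l x) A / absv l \<le> nrm (x - a)" if "a \<in> A" for a
  proof -
    have "approx_error nrm (scale l x) A \<le> nrm (scale l x - scale l a)"
      using assms(3) that by (intro approx_error_le) blast
    also have "\<dots> = nrm (x - a) * absv l"
      by (metis nrm_scale scale_right_diff_distrib mult.commute)
    finally show ?thesis
      using pos by (simp only: pos_divide_le_eq)
  qed
  then have "approx_error nrm (scale l x) A / absv l \<le> approx_error nrm x A"
    using assms(1) unfolding approx_error_def by (intro cINF_greatest)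
  then show ?thesis
    using pos by (simp add: field_simps)
qed

text \<open>The scaling bound at \<open>scale (inverse l) x\<close>: it carries an estimate for a
  rescaled vector back to \<open>x\<close>.\<close>

lemma approx_error_le_unscaled:
  assumes "A \<noteq> {}" "l \<noteq> 0" "scale l ` A \<subseteq> A"
  shows "approx_error nrm x A \<le> absv l * approx_error nrm (scale (inverse l) x) A"
  using approx_error_scale_le[OF assms, of "scale (inverse l) x"] assms(2) by simp

text \<open>If \<open>a\<close> is close to \<open>x\<close> and \<open>b\<close> to
  \<open>y\<close>, then \<open>a - b\<close> is as close to \<open>x - y\<close> as the worse of
  the two. The separate set \<open>C\<close> allows for an \<open>A\<close> that is not closed under
  subtraction.\<close>

lemma approx_error_diff_le_max:
  assumes ne: "A \<noteq> {}" and diff: "\<And>a b. a \<in> A \<Longrightarrow> b \<in> A \<Longrightarrow> a - b \<in> C"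
  shows "approx_error nrm (x - y) C \<le> max (approx_error nrm x A) (approx_error nrm y A)"
\<comment> \<open>The infima need not be attained, so the bound is shown for every \<open>r\<close>
  strictly above the maximum.\<close>
proof (rule dense_ge)
  fix r assume "max (approx_error nrm x A) (approx_error nrm y A) < r"
  then obtain a b where ab: "a \<in> A" "nrm (x - a) < r" "b \<in> A" "nrm (y - b) < r"
    using ne by (auto simp: approx_error_less_iff)
  have "approx_error nrm (x - y) C \<le> nrm ((x - a) - (y - b))"
    using approx_error_le[OF diff[OF ab(1,3)], of "x - y"] by (simp add: algebra_simps)
  also have "\<dots> \<le> max (nrm (x - a)) (nrm (y - b))"
    by (rule nrm_diff_le_max)
  finally show "approx_error nrm (x - y) C \<le> r"
    using ab by linarith
qed

text \<open>An approximant of \<open>y\<close> also serves for \<open>x\<close>. Hence the error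
  cannot drop when \<open>x\<close> is moved by less than its own error.\<close>

lemma approx_error_perturb:
  assumes ne: "A \<noteq> {}"
  shows "approx_error nrm x A \<le> max (nrm (x - y)) (approx_error nrm y A)"
proof (rule dense_ge)
  fix r assume "max (nrm (x - y)) (approx_error nrm y A) < r"
  then obtain a where a: "a \<in> A" "nrm (y - a) < r" "nrm (x - y) < r"
    using ne by (auto simp: approx_error_less_iff)
  have "approx_error nrm x A \<le> nrm ((x - y) + (y - a))"
    using approx_error_le[OF a(1), of x] by simp
  also have "\<dots> \<le> max (nrm (x - y)) (nrm (y - a))"
    by (rule nrm_add_le_max)
  finally show "approx_error nrm x A \<le> r"
    using a by linarith
qed

lemma closedin_approx_error_le:
  assumes "\<And>n. A n \<noteq> {}" "\<And>n. 0 \<le> b n"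
  shows "closedin (Metric_space.mtopology UNIV (\<lambda>x y. nrm (x - y)))
           {x. \<forall>n. approx_error nrm x (A n) \<le> b n}"
proof -
  interpret M: Metric_space UNIV "\<lambda>x y. nrm (x - y)"
    by (rule Metric_space_nrm)
  have "\<exists>r>0. disjnt {x. \<forall>n. approx_error nrm x (A n) \<le> b n} (M.mball x r)"
    if x: "b n < approx_error nrm x (A n)" for x n
  \<comment> \<open>The error of \<open>x\<close> itself is a suitable radius: inside that ball no
    error falls below that of \<open>x\<close>, so the bound \<open>b n\<close> stays
    violated.\<close>
  proof (intro exI[of _ "approx_error nrm x (A n)"] conjI)
    show "0 < approx_error nrm x (A n)"
      using assms(2)[of n] x by linarith
    have "b n < approx_error nrm y (A n)" if "nrm (x - y) < approx_error nrm x (A n)" for y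
      using approx_error_perturb[OF assms(1), of x n y] x that by linarith
    then show "disjnt {x. \<forall>n. approx_error nrm x (A n) \<le> b n}
        (M.mball x (approx_error nrm x (A n)))"
      by (fastforce simp: disjnt_iff not_le)
  qed
  then show ?thesis
    by (auto simp: M.closedin_metric not_le)
qed

end

section \<open>Approximation schemes and the errors of the unit ball\<close>

context ultrametric_approximation_scheme
begin

lemma A_mono: "m \<le> n \<Longrightarrow> A m \<subseteq> A n"
  by (rule lift_Suc_mono_le) (rule psubset_imp_subset[OF A_strict_chain])

lemma zero_in_A: "0 \<in> A n"
  using A_mono[of 0 n] A_0 by simp

lemma A_nonempty: "A n \<noteq> {}"
  using zero_in_A by blast

text \<open>Each \<open>A n\<close> is stable under scaling by -1, so a jump function for sums also
  works for differences.\<close>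

lemma A_diff:
  obtains K :: "nat \<Rightarrow> nat" where "\<And>n a b. a \<in> A n \<Longrightarrow> b \<in> A n \<Longrightarrow> a - b \<in> A (K n)"
proof -
  obtain K :: "nat \<Rightarrow> nat" where K: "\<And>n. {x + y | x y. x \<in> A n \<and> y \<in> A n} \<subseteq> A (K n)"
    using A_jump by blast
  have "a - b \<in> A (K n)" if "a \<in> A n" "b \<in> A n" for n a b
  proof -
    have "- b \<in> A n"
      using A_scale[of "-1" n] that(2) by (auto simp: image_subset_iff)
    then have "a + - b \<in> A (K n)"
      using K[of n] that(1) by blast
    then show ?thesis by simp
  qed
  then show thesis by (rule that)
qed

abbreviation ball_error :: "nat \<Rightarrow> real"
  where "ball_error n \<equiv> set_approx_error nrm (closed_unit_ball nrm) (A n)"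

lemma zero_in_ball: "0 \<in> closed_unit_ball nrm"
  by (simp add: closed_unit_ball_def nrm_zero)

lemma bdd_above_ball_error:
  "bdd_above ((\<lambda>b. approx_error nrm b (A n)) ` closed_unit_ball nrm)"
proof (rule bdd_aboveI2)
  fix x assume "x \<in> closed_unit_ball nrm"
  then show "approx_error nrm x (A n) \<le> 1"
    using approx_error_le[OF zero_in_A, of x n] by (simp add: closed_unit_ball_def)
qed

lemma approx_error_le_ball_error:
  "x \<in> closed_unit_ball nrm \<Longrightarrow> approx_error nrm x (A n) \<le> ball_error n"
  unfolding set_approx_error_def by (rule cSUP_upper[OF _ bdd_above_ball_error])

lemma ball_error_le:
  "(\<And>x. nrm x \<le> 1 \<Longrightarrow> approx_error nrm x (A n) \<le> r) \<Longrightarrow> ball_error n \<le> r"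
  unfolding set_approx_error_def using zero_in_ball
  by (intro cSUP_least) (auto simp: closed_unit_ball_def)

lemma ball_error_nonneg: "0 \<le> ball_error n"
  using approx_error_le_ball_error[OF zero_in_ball] approx_error_nonneg[OF A_nonempty]
  by (rule order_trans[rotated])

lemma decseq_ball_error: "decseq ball_error"
proof (intro decseq_SucI ball_error_le)
  fix n x assume "nrm x \<le> 1"
  then have "approx_error nrm x (A n) \<le> ball_error n"
    by (intro approx_error_le_ball_error) (simp add: closed_unit_ball_def)
  moreover have "approx_error nrm x (A (Suc n)) \<le> approx_error nrm x (A n)"
    by (intro approx_error_antimono A_nonempty A_mono) simp
  ultimately show "approx_error nrm x (A (Suc n)) \<le> ball_error n" by linarith
qed

lemma bdd_below_range_ball_error: "bdd_below (range ball_error)"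
  by (rule bdd_belowI[of _ 0]) (auto simp: ball_error_nonneg)

text \<open>A nonincreasing sequence bounded below converges to its infimum, which is nonnegative
  here. This turns (b) into a statement about a limit.\<close>

lemma INF_ball_error_pos_iff:
  "0 < (INF n. ball_error n) \<longleftrightarrow> \<not> ball_error \<longlonglongrightarrow> 0"
proof -
  have lim: "ball_error \<longlonglongrightarrow> (INF n. ball_error n)"
    by (rule LIMSEQ_decseq_INF[OF bdd_below_range_ball_error decseq_ball_error])
  moreover have "0 \<le> (INF n. ball_error n)"
    by (rule cINF_greatest) (auto simp: ball_error_nonneg)
  ultimately show ?thesis
    by (metis LIMSEQ_unique order_less_le)
qed

lemma approx_error_le_mult_ball_error:
  assumes "l \<noteq> 0" "nrm x \<le> absv l"
  shows "approx_error nrm x (A n) \<le> absv l * ball_error n"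
proof -
  have pos: "0 < absv l"
    using absv_nonneg[of l] absv_eq_0_iff[of l] assms(1) by simp
  have x: "scale l (scale (inverse l) x) = x"
    using assms(1) by simp
  \<comment> \<open>Keeping the factor \<open>absv l\<close> on both sides avoids computing the
    absolute value of \<open>inverse l\<close>.\<close>
  have "absv l * nrm (scale (inverse l) x) \<le> absv l * 1"
    using nrm_scale[of l "scale (inverse l) x"] x assms(2) by simp
  then have "scale (inverse l) x \<in> closed_unit_ball nrm"
    using pos by (simp add: closed_unit_ball_def)
  then have "absv l * approx_error nrm (scale (inverse l) x) (A n) \<le> absv l * ball_error n"
    using approx_error_le_ball_error pos by simp
  then show ?thesis
    using approx_error_le_unscaled[OF A_nonempty assms(1) A_scale] by (rule order_trans[rotated])
qed

end

section \<open>The two implications\<close>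

locale nontrivial_ultrametric_approximation_scheme =
  ultrametric_approximation_scheme absv scale nrm A
  + complete_nontrivial_nonarch_valued_field absv
  for absv :: "'k::field \<Rightarrow> real"
    and scale :: "'k \<Rightarrow> 'x::ab_group_add \<Rightarrow> 'x"
    and nrm :: "'x \<Rightarrow> real"
    and A :: "nat \<Rightarrow> 'x set"
begin

text \<open>The constant is the absolute value of a scalar dominating \<open>nrm x\<close>. So
  \<open>ball_error\<close> is the sequence that refutes (a) whenever it tends to 0.\<close>

lemma approx_error_bigo_ball_error:
  "\<exists>M>0. \<forall>n. approx_error nrm x (A n) \<le> M * ball_error n"
proof -
  obtain l where l: "l \<noteq> 0" "nrm x < absv l"
    by (rule absv_unbounded)
  then show ?thesis
    using approx_error_le_mult_ball_error[OF l(1), of x] nrm_nonneg[of x]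
    by (intro exI[of _ "absv l"]) auto
qed

text \<open>Baire's theorem makes the constant uniform: \<open>M\<close> depends on the vector in
  the hypothesis, but is the same on a whole ball in the conclusion.\<close>

lemma exists_ball_of_bounded_error:
  assumes nonneg: "\<And>n. 0 \<le> \<epsilon> n"
    and bigo: "\<And>x. \<exists>M>0. \<forall>n. approx_error nrm x (A n) \<le> M * \<epsilon> n"
  obtains M x r where "0 < r"
    "\<And>y n. nrm (x - y) < r \<Longrightarrow> approx_error nrm y (A n) \<le> M * \<epsilon> n"
proof -
  interpret M: Metric_space UNIV "\<lambda>x y. nrm (x - y)"
    by (rule Metric_space_nrm)
  \<comment> \<open>Natural constants make the cover countable; enlarging \<open>M\<close> to
    \<open>real k\<close> preserves the bound because \<epsilon> is nonnegative.\<close>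
  define F where "F k = {x. \<forall>n. approx_error nrm x (A n) \<le> real k * \<epsilon> n}" for k
  have closed: "closedin M.mtopology (F k)" for k
    unfolding F_def by (intro closedin_approx_error_le A_nonempty) (simp add: nonneg)
  have "\<exists>k. x \<in> F k" for x
  proof -
    obtain M where M: "\<And>n. approx_error nrm x (A n) \<le> M * \<epsilon> n"
      using bigo[of x] by blast
    obtain k where "M \<le> real k" using real_arch_simple by blast
    then have "x \<in> F k"
      unfolding F_def using M nonneg by (blast intro: order_trans mult_right_mono)
    then show ?thesis ..
  qed
  then have cover: "\<Union>(range F) = UNIV" by auto
  have "\<exists>k. M.mtopology interior_of F k \<noteq> {}"
  proof (rule ccontr)
    assume "\<not> ?thesis"
    then have "M.mtopology interior_of \<Union>(range F) = {}"
      using closed by (intro M.metric_Baire_category_alt nrm_complete) auto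
    moreover have "M.mtopology interior_of UNIV = UNIV"
      using interior_of_topspace[of M.mtopology] by simp
    ultimately show False using cover by simp
  qed
  then obtain k x where "x \<in> M.mtopology interior_of F k" by blast
  then obtain r where "0 < r" "M.mball x r \<subseteq> M.mtopology interior_of F k"
    using openin_interior_of[of M.mtopology "F k"] unfolding M.openin_mtopology by blast
  then have "0 < r" "M.mball x r \<subseteq> F k"
    using interior_of_subset[of M.mtopology "F k"] by auto
  then show thesis
    by (intro that[of r x "real k"]) (auto simp: F_def subset_iff)
qed

text \<open>The contrapositive of (b) implies (a): a single sequence \<epsilon> violating (a) forces
  the errors of the unit ball to 0.\<close>

lemma ball_error_tendsto_0:
  assumes dec: "decseq \<epsilon>" and lim: "\<epsilon> \<longlonglongrightarrow> 0"
    and bigo: "\<And>x. \<exists>M>0. \<forall>n. approx_error nrm x (A n) \<le> M * \<epsilon> n"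
  shows "ball_error \<longlonglongrightarrow> 0"
proof -
  have nonneg: "0 \<le> \<epsilon> n" for n
    using decseq_ge[OF dec lim] .
  obtain M x r where r: "0 < r"
    and ball: "\<And>y n. nrm (x - y) < r \<Longrightarrow> approx_error nrm y (A n) \<le> M * \<epsilon> n"
    using exists_ball_of_bounded_error[of \<epsilon>] nonneg bigo by metis
  obtain K :: "nat \<Rightarrow> nat" where K: "\<And>n a b. a \<in> A n \<Longrightarrow> b \<in> A n \<Longrightarrow> a - b \<in> A (K n)"
    using A_diff by blast
  \<comment> \<open>This size of \<open>l\<close> makes scaling by \<open>inverse l\<close> send the
    unit ball into the vectors of norm below \<open>r\<close>.\<close>
  obtain l where l: "l \<noteq> 0" "1 / r < absv l"
    by (rule absv_unbounded)
  have small: "approx_error nrm z (A (K n)) \<le> M * \<epsilon> n" if "nrm z < r" for z n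
  proof -
    \<comment> \<open>Here \<open>z\<close> is written as a difference of two points of the ball
      around \<open>x\<close>, the centre and \<open>x - z\<close>.\<close>
    have "approx_error nrm (x - (x - z)) (A (K n)) \<le>
        max (approx_error nrm x (A n)) (approx_error nrm (x - z) (A n))"
      by (rule approx_error_diff_le_max[OF A_nonempty K])
    moreover have "approx_error nrm x (A n) \<le> M * \<epsilon> n"
      using ball[of x n] r by (simp add: nrm_zero)
    moreover have "approx_error nrm (x - z) (A n) \<le> M * \<epsilon> n"
      using ball[of "x - z" n] that by simp
    ultimately show ?thesis by simp
  qed
  have pos: "0 < absv l"
    using l(2) r by (smt (verit) divide_pos_pos)
  have bound: "ball_error (K n) \<le> absv l * M * \<epsilon> n" for n
  proof (rule ball_error_le)
    fix z assume z: "nrm z \<le> 1"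
    have eq: "scale l (scale (inverse l) z) = z"
      using l(1) by simp
    have "absv l * nrm (scale (inverse l) z) < absv l * r"
      using nrm_scale[of l "scale (inverse l) z"] eq z l(2) r by (simp add: field_simps)
    then have "approx_error nrm (scale (inverse l) z) (A (K n)) \<le> M * \<epsilon> n"
      using pos by (intro small) simp
    then have "absv l * approx_error nrm (scale (inverse l) z) (A (K n)) \<le> absv l * (M * \<epsilon> n)"
      using pos by simp
    with approx_error_le_unscaled[OF A_nonempty l(1) A_scale]
    have "approx_error nrm z (A (K n)) \<le> absv l * (M * \<epsilon> n)"
      by (rule order_trans)
    then show "approx_error nrm z (A (K n)) \<le> absv l * M * \<epsilon> n"
      by (simp add: mult.assoc)
  qed
  have "(\<lambda>n. absv l * M * \<epsilon> n) \<longlonglongrightarrow> 0"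
    using tendsto_mult_right_zero[OF lim] .
  \<comment> \<open>The estimate holds only at the indices \<open>K n\<close>, which is enough to
    bound the infimum.\<close>
  moreover have "(INF n. ball_error n) \<le> absv l * M * \<epsilon> n" for n
    using cINF_lower[OF bdd_below_range_ball_error, of "K n"] bound[of n] by simp
  ultimately have "(INF n. ball_error n) \<le> 0"
    by (intro LIMSEQ_le_const) auto
  then show ?thesis
    using INF_ball_error_pos_iff by linarith
qed

end

theorem theorem2p1:
  fixes absv :: "'k::field \<Rightarrow> real"
    and scale :: "'k \<Rightarrow> 'x::ab_group_add \<Rightarrow> 'x"
    and nrm :: "'x \<Rightarrow> real"
    and A :: "nat \<Rightarrow> 'x set"
  assumes "complete_nontrivial_nonarch_valued_field absv"
    and "ultrametric_banach_space absv scale nrm"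
    and "ultrametric_approximation_scheme absv scale nrm A"
  shows "(\<forall>\<epsilon> :: nat \<Rightarrow> real. decseq \<epsilon> \<and> \<epsilon> \<longlonglongrightarrow> 0 \<longrightarrow>
            (\<exists>x. \<not> (\<exists>M>0. \<forall>n. approx_error nrm x (A n) \<le> M * \<epsilon> n)))
     \<longleftrightarrow> (INF n. set_approx_error nrm (closed_unit_ball nrm) (A n)) > 0"
proof -
  interpret nontrivial_ultrametric_approximation_scheme absv scale nrm A
    by (intro nontrivial_ultrametric_approximation_scheme.intro assms)
  show ?thesis
    unfolding INF_ball_error_pos_iff
    using ball_error_tendsto_0 approx_error_bigo_ball_error decseq_ball_error by blast
qed

end
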